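(* Let $L,N,M\ge1$ be integers with $M\ge L$, let $K=LN$, and let $\mathcal{P}_1,\dots,\mathcal{P}_{2^K}$ be an enumeration of all activation patterns $\mathcal{A}=(\mathcal{A}_1,\dots,\mathcal{A}_L)$ with $\mathcal{A}_l\subseteq\{1,\dots,N\}$. Let $\alpha_1,\dots,\alpha_{2^K}>0$ and $\alpha_\varepsilon=\min_{1\le i\le 2^K}\alpha_i$. Let $p'=(p'_1,\dots,p'_{2^K})$ and $p''=(p''_1,\dots,p''_{2^K})$ be independent random vectors, each distributed as $\mathrm{Dir}(\alpha_1,\dots,\alpha_{2^K})$, regarded as random probability mass functions on activation patterns via $p'(\mathcal{P}_i)=p'_i$ and $p''(\mathcal{P}_i)=p''_i$. Let $\mathbf{\Psi}$ be a (fixed) deterministic joint strategy, and put $\xi'=\mathbb{E}[\xi\mid\mathbf{\Psi},p']$ and $\xi''=\mathbb{E}[\xi\mid\mathbf{\Psi},p'']$. Then for every $\eta\in(0,1]$, $$P\big(|\xi'-\xi''|\ge\eta\big)\le\frac{1}{2\,\eta^2\,(1+\alpha_\varepsilon\,2^{K})}.$$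
   Context: Setting. There are $N$ nodes, $L$ shared messages and $M\ge L$ orthogonal transmission opportunities. An activation pattern is a tuple $\mathcal{A}=(\mathcal{A}_1,\dots,\mathcal{A}_L)$, where $\mathcal{A}_l\subseteq\{1,\dots,N\}$ is the set of nodes holding message $l$; there are $2^{LN}$ such patterns. A joint move is a tensor $\mathbf{X}=(x_{l,n,m})\in\{0,1\}^{L\times N\times M}$, where $x_{l,n,m}=1$ means that node $n$, when active for message $l$, transmits message $l$ over opportunity $m$. Success indicator. $\xi(\mathcal{A},\mathbf{X})\in\{0,1\}$ equals $1$ if and only if for every $l\in\{1,\dots,L\}$ there exists $m\in\{1,\dots,M\}$ such that $$\sum_{n\in\mathcal{A}_l}x_{l,n,m}=1\quad\text{and}\quad\sum_{\bar l\ne l}\ \sum_{\bar n\in\mathcal{A}_{\bar l}}x_{\bar l,\bar n,m}=0 .$$ Deterministic joint strategies. A joint strategy $\mathbf{\Psi}$ is a random variable on $\{0,1\}^{L\times N\times M}$ with probability mass function $\psi$; it is deterministic if $\psi$ takes values in $\{0,1\}$, i.e. it always selects one fixed joint move $\mathbf{X}$. For a probability mass function $p$ on activation patterns, the success probability is $$\mathbb{E}[\xi\mid\mathbf{\Psi},p]=\sum_{\mathcal{A}}p(\mathcal{A})\sum_{\mathbf{X}\in\{0,1\}^{L\times N\times M}}\xi(\mathcal{A},\mathbf{X})\,\psi(\mathbf{X}),$$ which for a deterministic strategy selecting $\mathbf{X}$ equals $\sum_{\mathcal{A}}p(\mathcal{A})\,\xi(\mathcal{A},\mathbf{X})$. $\mathrm{Dir}(\alpha_1,\dots,\alpha_{2^K})$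 denotes the Dirichlet distribution on the standard simplex $\{(p_1,\dots,p_{2^K}):p_i\ge0,\ \sum_i p_i=1\}$ with concentration parameters $\alpha_i>0$. *)

theory Defs
  imports "HOL-Probability.Probability"
begin

type_synonym pattern = "nat \<Rightarrow> nat set"
type_synonym joint_move = "nat \<times> nat \<times> nat \<Rightarrow> nat"

definition activation_patterns :: "nat \<Rightarrow> nat \<Rightarrow> pattern set" where
  "activation_patterns L N = {1..L} \<rightarrow>\<^sub>E Pow {1..N}"

definition joint_moves :: "nat \<Rightarrow> nat \<Rightarrow> nat \<Rightarrow> joint_move set" where
  "joint_moves L N M = ({1..L} \<times> {1..N} \<times> {1..M}) \<rightarrow>\<^sub>E {0, 1}"

definition success :: "nat \<Rightarrow> nat \<Rightarrow> pattern \<Rightarrow> joint_move \<Rightarrow> real" where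
  "success L M A X =
    (if \<forall>l\<in>{1..L}. \<exists>m\<in>{1..M}.
          (\<Sum>n\<in>A l. X (l, n, m)) = 1 \<and>
          (\<Sum>l'\<in>{1..L} - {l}. \<Sum>n'\<in>A l'. X (l', n', m)) = 0
     then 1 else 0)"

definition joint_strategy :: "nat \<Rightarrow> nat \<Rightarrow> nat \<Rightarrow> joint_move pmf \<Rightarrow> bool" where
  "joint_strategy L N M \<psi> \<longleftrightarrow> set_pmf \<psi> \<subseteq> joint_moves L N M"

definition deterministic :: "joint_move pmf \<Rightarrow> bool" where
  "deterministic \<psi> \<longleftrightarrow> (\<forall>X. pmf \<psi> X \<in> {0, 1})"

definition success_prob ::
    "nat \<Rightarrow> nat \<Rightarrow> nat \<Rightarrow> joint_move pmf \<Rightarrow> (pattern \<Rightarrow> real) \<Rightarrow> real" where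
  "success_prob L N M \<psi> p =
    (\<Sum>A\<in>activation_patterns L N. p A *
      (\<Sum>X\<in>joint_moves L N M. success L M A X * pmf \<psi> X))"

text \<open>If \<open>P\<close> enumerates a set bijectively by \<open>{1..n}\<close>, this is the function taking the
  value \<open>v i\<close> at \<open>P i\<close>.\<close>

definition mass_of_vector :: "nat \<Rightarrow> (nat \<Rightarrow> 'a) \<Rightarrow> (nat \<Rightarrow> real) \<Rightarrow> 'a \<Rightarrow> real" where
  "mass_of_vector n P v a = v (the_inv_into {1..n} P a)"

text \<open>The Dirichlet distribution has its usual density with respect to Lebesgue measure in the
  first \<open>n - 1\<close> coordinates of the simplex, the last one being determined by the others.
  It is a measure on the product space of \<open>n\<close> copies of the reals, giving no mass to the
  complement of the simplex.\<close>

definition dirichlet_density :: "nat \<Rightarrow> (nat \<Rightarrow> real) \<Rightarrow> (nat \<Rightarrow> real) \<Rightarrow> real" where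
  "dirichlet_density n \<alpha> x =
    (if (\<forall>i\<in>{1..n}. 0 \<le> x i) \<and> (\<Sum>i=1..n. x i) = 1
     then Gamma (\<Sum>i=1..n. \<alpha> i) / (\<Prod>i=1..n. Gamma (\<alpha> i)) *
          (\<Prod>i=1..n. x i powr (\<alpha> i - 1))
     else 0)"

definition complete_coordinates :: "nat \<Rightarrow> (nat \<Rightarrow> real) \<Rightarrow> nat \<Rightarrow> real" where
  "complete_coordinates n y = (\<lambda>i\<in>{1..n}. if i = n then 1 - (\<Sum>j\<in>{1..<n}. y j) else y i)"

definition dirichlet :: "nat \<Rightarrow> (nat \<Rightarrow> real) \<Rightarrow> (nat \<Rightarrow> real) measure" where
  "dirichlet n \<alpha> =
    distr
      (density (PiM {1..<n} (\<lambda>_. lborel))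
        (\<lambda>y. ennreal (dirichlet_density n \<alpha> (complete_coordinates n y))))
      (PiM {1..n} (\<lambda>_. borel))
      (complete_coordinates n)"

lemma measurable_complete_coordinates [measurable]:
  "complete_coordinates n \<in> measurable (PiM {1..<n} (\<lambda>_. lborel)) (PiM {1..n} (\<lambda>_. borel))"
  unfolding complete_coordinates_def
proof (rule measurable_restrict)
  fix i assume i: "i \<in> {1..n}"
  show "(\<lambda>y. if i = n then 1 - (\<Sum>j\<in>{1..<n}. y j) else y i)
      \<in> borel_measurable (PiM {1..<n} (\<lambda>_. lborel :: real measure))"
    using i by (cases "i = n") auto
qed

lemma measurable_dirichlet_density [measurable]:
  "dirichlet_density n \<alpha> \<in> borel_measurable (PiM {1..n} (\<lambda>_. borel))"
  unfolding dirichlet_density_def by measurable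

end

theory Submission
  imports Defs
begin

text \<open>The success probability of the strategy is an average \<open>\<Sum>i. c i * p i\<close> of the pattern
  probabilities with weights \<open>c i \<in> [0, 1]\<close>. If \<open>p\<close> is Dirichlet distributed with total parameter
  \<open>a\<close> and \<open>m\<close> is the mean of this average, its variance is at most
  \<open>m * (1 - m) / (a + 1) \<le> 1 / (4 * (a + 1))\<close>. The difference of two independent copies is centred
  with twice that variance, and Chebyshev's inequality applies; finally \<open>a \<ge> \<alpha>\<^sub>\<epsilon> * 2 ^ K\<close>.\<close>

declare One_nat_def [simp del]

section \<open>Power weights on the half-line and Dirichlet's integral\<close>

text \<open>The indicator carries the constraint \<open>0 \<le> x\<close>, so the simplex
  constraints sit inside the factors and all integrals can run over full product space.\<close>

definition simplex_weight :: "real \<Rightarrow> real \<Rightarrow> real" where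
  "simplex_weight a x = indicator {0..} x * x powr (a - 1)"

lemma simplex_weight_nonneg [simp]: "0 \<le> simplex_weight a x"
  by (simp add: simplex_weight_def)

lemma measurable_simplex_weight [measurable]: "simplex_weight a \<in> borel_measurable borel"
  unfolding simplex_weight_def by measurable

text \<open>The two indicators multiply to the indicator of \<open>{0..1}\<close>, which leaves the
  classical Beta integral.\<close>

lemma nn_integral_Beta:
  fixes a b :: real
  assumes "0 < a" "0 < b"
  shows "(\<integral>\<^sup>+ y. ennreal (simplex_weight a y * simplex_weight b (1 - y)) \<partial>lborel) = ennreal (Beta a b)"
proof -
  have "(\<integral>\<^sup>+ y. ennreal (y powr (a - 1) * (1 - y) powr (b - 1)) * indicator {0..1} y \<partial>lborel)
      = ennreal (Beta a b)"
    by (rule nn_integral_has_integral_lebesgue') (use has_integral_Beta_real assms in auto)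
  moreover have "ennreal (simplex_weight a y * simplex_weight b (1 - y))
      = ennreal (y powr (a - 1) * (1 - y) powr (b - 1)) * indicator {0..1} y" for y
    by (auto simp: simplex_weight_def indicator_def)
  ultimately show ?thesis by simp
qed

text \<open>The case \<open>s = 0\<close> is consistent because \<open>0 powr c = 0\<close> for every \<open>c\<close>.\<close>

lemma nn_integral_simplex_weight_convolution:
  fixes a b s :: real
  assumes ab: "0 < a" "0 < b"
  shows "(\<integral>\<^sup>+ y. ennreal (simplex_weight a y * simplex_weight b (s - y)) \<partial>lborel)
    = ennreal (Beta a b * simplex_weight (a + b) s)"
proof (cases "0 < s")
  case True
  \<comment> \<open>The weights are homogeneous of degree \<open>c - 1\<close>. Substituting
    \<open>s * y\<close> for \<open>y\<close> therefore extracts \<open>s powr (a + b - 2)\<close>,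
    and the Jacobian supplies one more factor \<open>s\<close>.\<close>
  have scale: "simplex_weight c (s * x) = s powr (c - 1) * simplex_weight c x" for c x
    using True by (auto simp: simplex_weight_def indicator_def powr_mult zero_le_mult_iff)
  have step: "simplex_weight a (s * y) * simplex_weight b (s - s * y)
      = s powr (a + b - 2) * (simplex_weight a y * simplex_weight b (1 - y))" for y
  proof -
    have "s - s * y = s * (1 - y)" by (simp add: algebra_simps)
    moreover have "s powr (a + b - 2) = s powr (a - 1) * s powr (b - 1)"
      by (simp add: powr_add[symmetric] add.commute)
    ultimately show ?thesis
      by (simp only: scale mult_ac)
  qed
  have "(\<integral>\<^sup>+ y. ennreal (simplex_weight a y * simplex_weight b (s - y)) \<partial>lborel)
    = ennreal s * (\<integral>\<^sup>+ y. ennreal (simplex_weight a (s * y) * simplex_weight b (s - s * y)) \<partial>lborel)"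
    using True by (subst nn_integral_real_affine[of _ s 0]) auto
  also have "\<dots> = ennreal s * (ennreal (s powr (a + b - 2)) * ennreal (Beta a b))"
    by (simp add: step ennreal_mult nn_integral_cmult nn_integral_Beta[OF ab, symmetric])
  also have "\<dots> = ennreal (Beta a b * simplex_weight (a + b) s)"
  proof -
    have "s powr (a + b - 1) = s * s powr (a + b - 2)"
      using True powr_add[of s 1 "a + b - 2"] by (simp add: algebra_simps)
    moreover have "0 \<le> Beta a b" using ab by (simp add: Beta_def)
    ultimately show ?thesis
      using True by (simp add: simplex_weight_def ennreal_mult[symmetric] mult_ac)
  qed
  finally show ?thesis .
next
  case False
  \<comment> \<open>For \<open>s \<le> 0\<close> both indicators can be nonzero only at
    \<open>y = 0\<close>, which is a null set.\<close>
  have "AE y in lborel. ennreal (simplex_weight a y * simplex_weight b (s - y)) = 0"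
    using AE_lborel_singleton[of 0]
    by eventually_elim (use False in \<open>auto simp: simplex_weight_def indicator_def\<close>)
  then have "(\<integral>\<^sup>+ y. ennreal (simplex_weight a y * simplex_weight b (s - y)) \<partial>lborel) = 0"
    by (subst nn_integral_0_iff_AE) auto
  moreover have "simplex_weight (a + b) s = 0"
    using False by (auto simp: simplex_weight_def indicator_def)
  ultimately show ?thesis by simp
qed

text \<open>Dirichlet's integral, by repeated convolution. Integrating out coordinate
  \<open>j\<close> with the others fixed merges \<open>a j\<close> into the last parameter, which
  becomes \<open>a j + b\<close>; hence the induction keeps \<open>b\<close> arbitrary.\<close>

lemma nn_integral_simplex_weight_prod:
  fixes a :: "'i \<Rightarrow> real" and b t :: real
  assumes "finite I" "\<And>i. i \<in> I \<Longrightarrow> 0 < a i" "0 < b"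
  shows "(\<integral>\<^sup>+ y. ennreal ((\<Prod>i\<in>I. simplex_weight (a i) (y i)) * simplex_weight b (t - (\<Sum>i\<in>I. y i)))
        \<partial>PiM I (\<lambda>_. lborel))
    = ennreal ((\<Prod>i\<in>I. Gamma (a i)) * Gamma b / Gamma ((\<Sum>i\<in>I. a i) + b)
        * simplex_weight ((\<Sum>i\<in>I. a i) + b) t)"
  using assms
proof (induction I arbitrary: b)
  case empty
  then show ?case
    by (simp add: PiM_empty nn_integral_count_space_finite less_imp_neq[THEN not_sym] Gamma_real_pos)
next
  case (insert j I)
  interpret product_sigma_finite "\<lambda>_::'i. lborel :: real measure"
    by standard
  let ?w = "simplex_weight"
  let ?P = "\<lambda>y. \<Prod>i\<in>I. ?w (a i) (y i)"
  have aj: "0 < a j" and ai: "\<And>i. i \<in> I \<Longrightarrow> 0 < a i" using insert.prems by auto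
  have upd: "(\<Prod>i\<in>insert j I. ?w (a i) ((y(j := x)) i)) * ?w b (t - (\<Sum>i\<in>insert j I. (y(j := x)) i))
      = ?P y * (?w (a j) x * ?w b ((t - (\<Sum>i\<in>I. y i)) - x))" for y x
  proof -
    have "(\<Prod>i\<in>I. ?w (a i) ((y(j := x)) i)) = ?P y" "(\<Sum>i\<in>I. (y(j := x)) i) = (\<Sum>i\<in>I. y i)"
      using insert.hyps by (auto intro!: prod.cong sum.cong)
    then show ?thesis
      using insert.hyps by (simp add: algebra_simps)
  qed
  have P0: "0 \<le> ?P y" for y by (intro prod_nonneg) auto
  have B0: "0 \<le> Beta (a j) b" using aj insert.prems(2) by (simp add: Beta_def)
  have inner: "(\<integral>\<^sup>+ x. ennreal (?P y * (?w (a j) x * ?w b ((t - (\<Sum>i\<in>I. y i)) - x))) \<partial>lborel)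
      = ennreal (Beta (a j) b) * ennreal (?P y * ?w (a j + b) (t - (\<Sum>i\<in>I. y i)))" for y
  proof -
    have "(\<integral>\<^sup>+ x. ennreal (?P y * (?w (a j) x * ?w b ((t - (\<Sum>i\<in>I. y i)) - x))) \<partial>lborel)
      = ennreal (?P y) * ennreal (Beta (a j) b * ?w (a j + b) (t - (\<Sum>i\<in>I. y i)))"
      unfolding nn_integral_simplex_weight_convolution[OF aj insert.prems(2), symmetric]
      by (subst nn_integral_cmult[symmetric]) (simp_all add: ennreal_mult'[OF P0])
    then show ?thesis
      using P0 B0 by (simp add: ennreal_mult' mult_ac)
  qed
  have "(\<integral>\<^sup>+ y. ennreal ((\<Prod>i\<in>insert j I. ?w (a i) (y i)) * ?w b (t - (\<Sum>i\<in>insert j I. y i)))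
        \<partial>PiM (insert j I) (\<lambda>_. lborel))
    = (\<integral>\<^sup>+ y. (\<integral>\<^sup>+ x. ennreal (?P y * (?w (a j) x * ?w b ((t - (\<Sum>i\<in>I. y i)) - x))) \<partial>lborel)
        \<partial>PiM I (\<lambda>_. lborel))"
    using insert.hyps by (subst product_nn_integral_insert) (simp_all only: upd, measurable)
  also have "\<dots> = ennreal (Beta (a j) b) *
      (\<integral>\<^sup>+ y. ennreal (?P y * ?w (a j + b) (t - (\<Sum>i\<in>I. y i))) \<partial>PiM I (\<lambda>_. lborel))"
    by (simp add: inner nn_integral_cmult)
  also have "\<dots> = ennreal (Beta (a j) b) * ennreal ((\<Prod>i\<in>I. Gamma (a i)) * Gamma (a j + b)
      / Gamma ((\<Sum>i\<in>I. a i) + (a j + b)) * ?w ((\<Sum>i\<in>I. a i) + (a j + b)) t)"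
    using insert.IH[of "a j + b"] ai aj insert.prems(2) by simp
  also have "\<dots> = ennreal (Beta (a j) b * ((\<Prod>i\<in>I. Gamma (a i)) * Gamma (a j + b)
      / Gamma ((\<Sum>i\<in>I. a i) + (a j + b)) * ?w ((\<Sum>i\<in>I. a i) + (a j + b)) t))"
    by (rule ennreal_mult'[OF B0, symmetric])
  also have "Beta (a j) b * ((\<Prod>i\<in>I. Gamma (a i)) * Gamma (a j + b)
      / Gamma ((\<Sum>i\<in>I. a i) + (a j + b)) * ?w ((\<Sum>i\<in>I. a i) + (a j + b)) t)
    = (\<Prod>i\<in>insert j I. Gamma (a i)) * Gamma b / Gamma ((\<Sum>i\<in>insert j I. a i) + b)
        * ?w ((\<Sum>i\<in>insert j I. a i) + b) t"
  proof -
    \<comment> \<open>The Gamma factors telescope: \<open>Gamma (a j + b)\<close> is the denominator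
      of \<open>Beta (a j) b\<close> and a numerator in the induction hypothesis.\<close>
    have "Gamma (a j + b) \<noteq> 0" using aj insert.prems(2) Gamma_real_pos[of "a j + b"] by linarith
    then show ?thesis
      using insert.hyps by (simp add: Beta_def add_ac mult_ac)
  qed
  finally show ?case .
qed

section \<open>Normalisation and support of the Dirichlet law\<close>

definition dirichlet_const :: "nat \<Rightarrow> (nat \<Rightarrow> real) \<Rightarrow> real" where
  "dirichlet_const n \<alpha> = Gamma (\<Sum>i=1..n. \<alpha> i) / (\<Prod>i=1..n. Gamma (\<alpha> i))"

lemma atLeastAtMost_insert_last: "1 \<le> n \<Longrightarrow> {1..n} = insert n {1..<n}" for n :: nat
  by auto

lemma sum_complete_coordinates:
  assumes "1 \<le> n"
  shows "(\<Sum>i=1..n. complete_coordinates n y i) = 1"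
proof -
  have "(\<Sum>i=1..n. complete_coordinates n y i)
      = complete_coordinates n y n + (\<Sum>i\<in>{1..<n}. complete_coordinates n y i)"
    using assms by (simp add: atLeastAtMost_insert_last)
  also have "(\<Sum>i\<in>{1..<n}. complete_coordinates n y i) = (\<Sum>i\<in>{1..<n}. y i)"
    by (intro sum.cong) (auto simp: complete_coordinates_def)
  finally show ?thesis using assms by (simp add: complete_coordinates_def)
qed

lemma sum_pos_atLeastAtMost:
  fixes \<alpha> :: "nat \<Rightarrow> real"
  assumes "1 \<le> n" "\<And>i. i \<in> {1..n} \<Longrightarrow> 0 < \<alpha> i"
  shows "0 < (\<Sum>i=1..n. \<alpha> i)"
  using assms by (intro sum_pos) auto

lemma dirichlet_const_pos:
  assumes "1 \<le> n" "\<And>i. i \<in> {1..n} \<Longrightarrow> 0 < \<alpha> i"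
  shows "0 < dirichlet_const n \<alpha>"
  using assms sum_pos_atLeastAtMost[OF assms]
  by (auto simp: dirichlet_const_def intro!: divide_pos_pos prod_pos)

lemma dirichlet_density_nonneg:
  assumes "1 \<le> n" "\<And>i. i \<in> {1..n} \<Longrightarrow> 0 < \<alpha> i"
  shows "0 \<le> dirichlet_density n \<alpha> x"
  using dirichlet_const_pos[of n \<alpha>, OF assms]
  by (auto simp: dirichlet_density_def dirichlet_const_def[symmetric] intro!: mult_nonneg_nonneg prod_nonneg)

text \<open>Completed coordinates always sum to 1, and the sign conditions are absorbed by the
  weights. The density thus becomes the integrand of Dirichlet's integral with \<open>t = 1\<close>
  and last parameter \<open>\<alpha> n\<close>.\<close>

lemma dirichlet_density_complete_coordinates:
  assumes n: "1 \<le> n"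
  shows "dirichlet_density n \<alpha> (complete_coordinates n y)
    = dirichlet_const n \<alpha> * ((\<Prod>i\<in>{1..<n}. simplex_weight (\<alpha> i) (y i))
        * simplex_weight (\<alpha> n) (1 - (\<Sum>i\<in>{1..<n}. y i)))"
proof -
  let ?x = "complete_coordinates n y"
  have xn: "?x n = 1 - (\<Sum>i\<in>{1..<n}. y i)" using n by (simp add: complete_coordinates_def)
  have xi: "?x i = y i" if "i \<in> {1..<n}" for i using that by (simp add: complete_coordinates_def)
  have "dirichlet_density n \<alpha> ?x = dirichlet_const n \<alpha> * (\<Prod>i=1..n. simplex_weight (\<alpha> i) (?x i))"
  proof (cases "\<forall>i\<in>{1..n}. 0 \<le> ?x i")
    case True
    then have "(\<Prod>i=1..n. simplex_weight (\<alpha> i) (?x i)) = (\<Prod>i=1..n. ?x i powr (\<alpha> i - 1))"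
      by (intro prod.cong) (auto simp: simplex_weight_def)
    then show ?thesis
      using True sum_complete_coordinates[OF n, of y]
      by (simp add: dirichlet_density_def dirichlet_const_def)
  next
    case False
    then have "(\<Prod>i=1..n. simplex_weight (\<alpha> i) (?x i)) = 0"
      by (intro prod_zero) (auto simp: simplex_weight_def indicator_def)
    then show ?thesis
      using False unfolding dirichlet_density_def by auto
  qed
  also have "(\<Prod>i=1..n. simplex_weight (\<alpha> i) (?x i))
      = simplex_weight (\<alpha> n) (?x n) * (\<Prod>i\<in>{1..<n}. simplex_weight (\<alpha> i) (?x i))"
    using n by (simp add: atLeastAtMost_insert_last)
  also have "(\<Prod>i\<in>{1..<n}. simplex_weight (\<alpha> i) (?x i)) = (\<Prod>i\<in>{1..<n}. simplex_weight (\<alpha> i) (y i))"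
    by (intro prod.cong) (auto simp: xi)
  finally show ?thesis by (simp add: xn mult_ac)
qed

lemma sets_dirichlet [simp, measurable_cong]: "sets (dirichlet n \<alpha>) = sets (PiM {1..n} (\<lambda>_. borel))"
  by (simp add: dirichlet_def)

text \<open>At \<open>t = 1\<close> the remaining weight equals 1, so Dirichlet's integral is
  exactly the reciprocal of the normalising constant.\<close>

lemma prob_space_dirichlet:
  assumes n: "1 \<le> n" and \<alpha>: "\<And>i. i \<in> {1..n} \<Longrightarrow> 0 < \<alpha> i"
  shows "prob_space (dirichlet n \<alpha>)"
proof
  let ?L = "PiM {1..<n} (\<lambda>_. lborel :: real measure)"
  let ?B = "PiM {1..n} (\<lambda>_. borel :: real measure)"
  let ?f = "\<lambda>y. (\<Prod>i\<in>{1..<n}. simplex_weight (\<alpha> i) (y i))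
        * simplex_weight (\<alpha> n) (1 - (\<Sum>i\<in>{1..<n}. y i))"
  note c0 = dirichlet_const_pos[of n \<alpha>, OF n \<alpha>]
  have "emeasure (dirichlet n \<alpha>) (space (dirichlet n \<alpha>)) = (\<integral>\<^sup>+ x. 1 \<partial>dirichlet n \<alpha>)"
    by simp
  also have "\<dots> = (\<integral>\<^sup>+ y. ennreal (dirichlet_density n \<alpha> (complete_coordinates n y)) \<partial>?L)"
    unfolding dirichlet_def by (simp add: nn_integral_distr nn_integral_density del: nn_integral_const)
  also have "\<dots> = ennreal (dirichlet_const n \<alpha>) * (\<integral>\<^sup>+ y. ennreal (?f y) \<partial>?L)"
    using c0 by (simp add: dirichlet_density_complete_coordinates[OF n] ennreal_mult' nn_integral_cmult)
  also have "(\<integral>\<^sup>+ y. ennreal (?f y) \<partial>?L) = ennreal ((\<Prod>i\<in>{1..<n}. Gamma (\<alpha> i)) * Gamma (\<alpha> n)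
      / Gamma ((\<Sum>i\<in>{1..<n}. \<alpha> i) + \<alpha> n))"
    using n \<alpha> by (subst nn_integral_simplex_weight_prod) (auto simp: simplex_weight_def)
  also have "(\<Prod>i\<in>{1..<n}. Gamma (\<alpha> i)) * Gamma (\<alpha> n) / Gamma ((\<Sum>i\<in>{1..<n}. \<alpha> i) + \<alpha> n)
      = 1 / dirichlet_const n \<alpha>"
    using n by (simp add: dirichlet_const_def atLeastAtMost_insert_last add_ac mult_ac)
  finally show "emeasure (dirichlet n \<alpha>) (space (dirichlet n \<alpha>)) = 1"
    using c0 by (simp add: ennreal_mult'[symmetric])
qed

text \<open>The density is 0 off the simplex, so the simplex has full measure.\<close>

lemma AE_dirichlet_simplex:
  assumes "1 \<le> n"
  shows "AE x in dirichlet n \<alpha>. (\<forall>i\<in>{1..n}. 0 \<le> x i) \<and> (\<Sum>i=1..n. x i) = 1"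
  unfolding dirichlet_def
  by (subst AE_distr_iff) (auto simp: AE_density dirichlet_density_def)

section \<open>Integration against the Dirichlet law and size biasing\<close>

text \<open>Measurability of \<open>f\<close> suffices for both changes of measure, so size biasing
  can be carried out before any integrability is known.\<close>

lemma integral_dirichlet:
  fixes f :: "(nat \<Rightarrow> real) \<Rightarrow> real"
  assumes "1 \<le> n" "\<And>i. i \<in> {1..n} \<Longrightarrow> 0 < \<alpha> i"
    and [measurable]: "f \<in> borel_measurable (PiM {1..n} (\<lambda>_. borel))"
  shows "(\<integral>x. f x \<partial>dirichlet n \<alpha>)
    = (\<integral>y. dirichlet_density n \<alpha> (complete_coordinates n y) * f (complete_coordinates n y)
        \<partial>PiM {1..<n} (\<lambda>_. lborel))"
proof -
  have "AE y in PiM {1..<n} (\<lambda>_. lborel). 0 \<le> dirichlet_density n \<alpha> (complete_coordinates n y)"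
    by (intro AE_I2 dirichlet_density_nonneg[of n \<alpha>, OF assms(1,2)])
  then show ?thesis
    unfolding dirichlet_def by (simp add: integral_distr integral_density)
qed

text \<open>Size biasing: weighting a Dirichlet law by one coordinate raises that parameter by one, so
  every moment reduces to the normalisation of a Dirichlet law.\<close>

lemma dirichlet_density_size_bias:
  assumes n: "1 \<le> n" and \<alpha>: "\<And>i. i \<in> {1..n} \<Longrightarrow> 0 < \<alpha> i" and j: "j \<in> {1..n}"
  shows "dirichlet_density n \<alpha> x * x j
    = \<alpha> j / (\<Sum>i=1..n. \<alpha> i) * dirichlet_density n (\<alpha>(j := \<alpha> j + 1)) x"
proof (cases "(\<forall>i\<in>{1..n}. 0 \<le> x i) \<and> (\<Sum>i=1..n. x i) = 1")
  case True
  let ?\<alpha>' = "\<alpha>(j := \<alpha> j + 1)"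
  let ?R = "{1..n} - {j}"
  define s where "s = (\<Sum>i=1..n. \<alpha> i)"
  define p where "p = (\<Prod>i=1..n. Gamma (\<alpha> i))"
  have s: "0 < s" unfolding s_def by (rule sum_pos_atLeastAtMost[of n \<alpha>, OF n \<alpha>])
  have p: "0 < p" unfolding p_def using \<alpha> by (intro prod_pos) auto
  have aj: "0 < \<alpha> j" using \<alpha> j by simp
  \<comment> \<open>Raising \<open>\<alpha> j\<close> by one adds 1 to the total and multiplies the
    Gamma product by \<open>\<alpha> j\<close>. By the functional equation of \<open>Gamma\<close>
    the two normalising constants then differ by the factor \<open>s / \<alpha> j\<close>.\<close>
  have s': "(\<Sum>i=1..n. ?\<alpha>' i) = s + 1"
    unfolding s_def using j by (simp add: sum.remove[of _ j])
  have p': "(\<Prod>i=1..n. Gamma (?\<alpha>' i)) = \<alpha> j * p"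
  proof -
    have "(\<Prod>i\<in>?R. Gamma (?\<alpha>' i)) = (\<Prod>i\<in>?R. Gamma (\<alpha> i))" by (intro prod.cong) auto
    moreover have "Gamma (\<alpha> j + 1) = \<alpha> j * Gamma (\<alpha> j)"
      using aj by (intro Gamma_plus1) (auto elim!: nonpos_Ints_cases')
    ultimately show ?thesis
      unfolding p_def using j by (simp add: prod.remove[of _ j])
  qed
  have g: "Gamma (s + 1) = s * Gamma s"
    using s by (intro Gamma_plus1) (auto elim!: nonpos_Ints_cases')
  have x': "(\<Prod>i=1..n. x i powr (?\<alpha>' i - 1)) = x j * (\<Prod>i=1..n. x i powr (\<alpha> i - 1))"
  proof -
    have "(\<Prod>i\<in>?R. x i powr (?\<alpha>' i - 1)) = (\<Prod>i\<in>?R. x i powr (\<alpha> i - 1))" by (intro prod.cong) auto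
    \<comment> \<open>At \<open>x j = 0\<close> both sides are 0 by the convention
      \<open>0 powr c = 0\<close>, even if \<open>\<alpha> j < 1\<close>.\<close>
    moreover have "x j powr \<alpha> j = x j * x j powr (\<alpha> j - 1)"
      using True j powr_add[of "x j" 1 "\<alpha> j - 1"] by (cases "x j = 0") auto
    ultimately show ?thesis
      using j by (simp add: prod.remove[of _ j])
  qed
  show ?thesis
    unfolding dirichlet_density_def s' p' x' s_def[symmetric] p_def[symmetric] g
    using True s p aj by simp
qed (auto simp: dirichlet_density_def)

text \<open>With \<open>f = 1\<close> this gives the means of the coordinates; with \<open>f\<close>
  linear it reduces second moments to means under shifted parameters.\<close>

lemma integral_dirichlet_size_bias:
  fixes f :: "(nat \<Rightarrow> real) \<Rightarrow> real"
  assumes n: "1 \<le> n" and \<alpha>: "\<And>i. i \<in> {1..n} \<Longrightarrow> 0 < \<alpha> i" and j: "j \<in> {1..n}"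
    and f [measurable]: "f \<in> borel_measurable (PiM {1..n} (\<lambda>_. borel))"
  shows "(\<integral>x. x j * f x \<partial>dirichlet n \<alpha>)
    = \<alpha> j / (\<Sum>i=1..n. \<alpha> i) * (\<integral>x. f x \<partial>dirichlet n (\<alpha>(j := \<alpha> j + 1)))"
proof -
  let ?\<alpha>' = "\<alpha>(j := \<alpha> j + 1)"
  let ?cc = "complete_coordinates n"
  have "(\<lambda>x. x j) \<in> borel_measurable (PiM {1..n} (\<lambda>_. borel :: real measure))"
    using j by measurable
  then have xf: "(\<lambda>x. x j * f x) \<in> borel_measurable (PiM {1..n} (\<lambda>_. borel))"
    using f by measurable
  have \<alpha>': "0 < ?\<alpha>' i" if "i \<in> {1..n}" for i
    using \<alpha>[OF that] by (auto intro: add_pos_pos)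
  have "dirichlet_density n \<alpha> (?cc y) * (?cc y j * f (?cc y))
      = \<alpha> j / (\<Sum>i=1..n. \<alpha> i) * (dirichlet_density n ?\<alpha>' (?cc y) * f (?cc y))" for y
    using dirichlet_density_size_bias[of n \<alpha>, OF n \<alpha> j, of "?cc y"] by (simp only: mult.assoc[symmetric])
  then have "(\<integral>x. x j * f x \<partial>dirichlet n \<alpha>) = (\<integral>y. \<alpha> j / (\<Sum>i=1..n. \<alpha> i)
      * (dirichlet_density n ?\<alpha>' (?cc y) * f (?cc y)) \<partial>PiM {1..<n} (\<lambda>_. lborel))"
    by (simp only: integral_dirichlet[of n \<alpha>, OF n \<alpha> xf])
  also have "\<dots> = \<alpha> j / (\<Sum>i=1..n. \<alpha> i) * (\<integral>x. f x \<partial>dirichlet n ?\<alpha>')"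
    by (simp only: integral_dirichlet[of n ?\<alpha>', OF n \<alpha>' f] integral_mult_right_zero)
  finally show ?thesis .
qed

section \<open>First and second moments of linear averages\<close>

text \<open>The bound is asked for on the simplex only, since linear functions are in general
  unbounded off it; the simplex has full measure in a probability space.\<close>

lemma integrable_dirichlet_bounded:
  fixes f :: "(nat \<Rightarrow> real) \<Rightarrow> real"
  assumes n: "1 \<le> n" and \<alpha>: "\<And>i. i \<in> {1..n} \<Longrightarrow> 0 < \<alpha> i"
    and f: "f \<in> borel_measurable (PiM {1..n} (\<lambda>_. borel))"
    and le: "\<And>x. (\<forall>i\<in>{1..n}. 0 \<le> x i) \<Longrightarrow> (\<Sum>i=1..n. x i) = 1 \<Longrightarrow> \<bar>f x\<bar> \<le> B"
  shows "integrable (dirichlet n \<alpha>) f"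
proof -
  interpret prob_space "dirichlet n \<alpha>" by (rule prob_space_dirichlet[OF n \<alpha>])
  show ?thesis
  proof (rule integrable_const_bound)
    show "AE x in dirichlet n \<alpha>. norm (f x) \<le> B"
      using AE_dirichlet_simplex[OF n] by eventually_elim (use le in auto)
    show "f \<in> borel_measurable (dirichlet n \<alpha>)" using f by simp
  qed
qed

lemma simplex_coordinate_le_1:
  fixes x :: "nat \<Rightarrow> real"
  assumes "\<forall>i\<in>{1..n}. 0 \<le> x i" "(\<Sum>i=1..n. x i) = 1" "j \<in> {1..n}"
  shows "\<bar>x j\<bar> \<le> 1"
  using member_le_sum[of j "{1..n}" x] assms by auto

lemma simplex_average_le_1:
  fixes c x :: "nat \<Rightarrow> real"
  assumes "\<forall>i\<in>{1..n}. 0 \<le> x i" "(\<Sum>i=1..n. x i) = 1" "\<And>i. i \<in> {1..n} \<Longrightarrow> 0 \<le> c i \<and> c i \<le> 1"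
  shows "\<bar>\<Sum>i=1..n. c i * x i\<bar> \<le> 1"
proof -
  have "(\<Sum>i=1..n. c i * x i) \<le> (\<Sum>i=1..n. x i)"
    using assms by (intro sum_mono mult_left_le_one_le) auto
  moreover have "0 \<le> (\<Sum>i=1..n. c i * x i)"
    using assms by (intro sum_nonneg) auto
  ultimately show ?thesis using assms(2) by simp
qed

lemma measurable_PiM_linear:
  "(\<lambda>x. \<Sum>i=1..n. c i * x i) \<in> borel_measurable (PiM {1..n} (\<lambda>_. borel :: real measure))"
  by measurable

lemma dirichlet_mean_linear:
  fixes c :: "nat \<Rightarrow> real"
  assumes n: "1 \<le> n" and \<alpha>: "\<And>i. i \<in> {1..n} \<Longrightarrow> 0 < \<alpha> i"
  shows "(\<integral>x. (\<Sum>i=1..n. c i * x i) \<partial>dirichlet n \<alpha>) = (\<Sum>i=1..n. c i * \<alpha> i) / (\<Sum>i=1..n. \<alpha> i)"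
proof -
  have mean: "(\<integral>x. x j \<partial>dirichlet n \<alpha>) = \<alpha> j / (\<Sum>i=1..n. \<alpha> i)" if j: "j \<in> {1..n}" for j
  proof -
    \<comment> \<open>In size biasing with \<open>f = 1\<close>, the integral on the right is the
      total mass of this shifted law.\<close>
    interpret prob_space "dirichlet n (\<alpha>(j := \<alpha> j + 1))"
      using \<alpha> by (intro prob_space_dirichlet[OF n]) (simp add: add_pos_pos)
    show ?thesis
      using integral_dirichlet_size_bias[OF n \<alpha> j, where f = "\<lambda>_. 1"] by (simp add: prob_space)
  qed
  have int: "integrable (dirichlet n \<alpha>) (\<lambda>x. x j)" if j: "j \<in> {1..n}" for j
  proof (rule integrable_dirichlet_bounded[where B = 1, OF n \<alpha>])
    show "(\<lambda>x. x j) \<in> borel_measurable (PiM {1..n} (\<lambda>_. borel))" using j by measurable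
  qed (use simplex_coordinate_le_1 j in blast)+
  have "(\<integral>x. (\<Sum>i=1..n. c i * x i) \<partial>dirichlet n \<alpha>) = (\<Sum>i=1..n. c i * (\<integral>x. x i \<partial>dirichlet n \<alpha>))"
    using int by (subst Bochner_Integration.integral_sum) auto
  then show ?thesis by (simp add: mean sum_divide_distrib)
qed

text \<open>Expand one factor of the square as a sum of terms \<open>c j * x j\<close>. Size biasing
  removes \<open>x j\<close> and leaves the mean of the linear function with
  \<open>\<alpha> j\<close> raised by one; that shift turns \<open>s\<close> into
  \<open>s + c j\<close> and \<open>a\<close> into \<open>a + 1\<close>.\<close>

lemma dirichlet_second_moment_linear:
  fixes c :: "nat \<Rightarrow> real"
  assumes n: "1 \<le> n" and \<alpha>: "\<And>i. i \<in> {1..n} \<Longrightarrow> 0 < \<alpha> i"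
    and c: "\<And>i. i \<in> {1..n} \<Longrightarrow> 0 \<le> c i \<and> c i \<le> 1"
  shows "(\<integral>x. (\<Sum>i=1..n. c i * x i)\<^sup>2 \<partial>dirichlet n \<alpha>)
    = (\<Sum>j=1..n. c j * \<alpha> j * ((\<Sum>i=1..n. c i * \<alpha> i) + c j))
      / ((\<Sum>i=1..n. \<alpha> i) * ((\<Sum>i=1..n. \<alpha> i) + 1))"
proof -
  define f where "f = (\<lambda>x::nat \<Rightarrow> real. \<Sum>i=1..n. c i * x i)"
  define a where "a = (\<Sum>i=1..n. \<alpha> i)"
  define s where "s = (\<Sum>i=1..n. c i * \<alpha> i)"
  have f_meas [measurable]: "f \<in> borel_measurable (PiM {1..n} (\<lambda>_. borel))"
    unfolding f_def by (rule measurable_PiM_linear)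
  have mixed: "(\<integral>x. x j * f x \<partial>dirichlet n \<alpha>) = \<alpha> j / a * ((s + c j) / (a + 1))" if j: "j \<in> {1..n}" for j
  proof -
    have "(\<Sum>i=1..n. c i * (\<alpha>(j := \<alpha> j + 1)) i) = s + c j"
      unfolding s_def using j by (simp add: sum.remove[of _ j] algebra_simps)
    moreover have "(\<Sum>i=1..n. (\<alpha>(j := \<alpha> j + 1)) i) = a + 1"
      unfolding a_def using j by (simp add: sum.remove[of _ j])
    moreover have "0 < (\<alpha>(j := \<alpha> j + 1)) i" if "i \<in> {1..n}" for i
      using \<alpha>[OF that] by (auto intro: add_pos_pos)
    ultimately have "(\<integral>x. f x \<partial>dirichlet n (\<alpha>(j := \<alpha> j + 1))) = (s + c j) / (a + 1)"
      unfolding f_def by (subst dirichlet_mean_linear[OF n]) auto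
    then show ?thesis
      using integral_dirichlet_size_bias[OF n \<alpha> j f_meas] by (simp add: a_def)
  qed
  have int: "integrable (dirichlet n \<alpha>) (\<lambda>x. x j * f x)" if j: "j \<in> {1..n}" for j
  proof (rule integrable_dirichlet_bounded[where B = 1, OF n \<alpha>])
    show "(\<lambda>x. x j * f x) \<in> borel_measurable (PiM {1..n} (\<lambda>_. borel))" using j by measurable
  next
    fix x :: "nat \<Rightarrow> real" assume x: "\<forall>i\<in>{1..n}. 0 \<le> x i" "(\<Sum>i=1..n. x i) = 1"
    show "\<bar>x j * f x\<bar> \<le> 1"
      using simplex_coordinate_le_1[OF x j] simplex_average_le_1[OF x c]
      unfolding f_def abs_mult by (intro mult_le_one) auto
  qed
  have "(\<integral>x. (f x)\<^sup>2 \<partial>dirichlet n \<alpha>) = (\<integral>x. (\<Sum>j=1..n. c j * (x j * f x)) \<partial>dirichlet n \<alpha>)"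
    by (simp add: power2_eq_square f_def sum_distrib_right mult.assoc)
  also have "\<dots> = (\<Sum>j=1..n. c j * (\<integral>x. x j * f x \<partial>dirichlet n \<alpha>))"
    using int by (subst Bochner_Integration.integral_sum) auto
  also have "\<dots> = (\<Sum>j=1..n. c j * \<alpha> j * (s + c j)) / (a * (a + 1))"
    by (simp add: mixed sum_divide_distrib mult.assoc)
  finally show ?thesis unfolding f_def s_def a_def .
qed

text \<open>The worst case is weights in {0, 1}. For \<open>0 < s < a\<close> the intermediate bound
  \<open>m * (1 - m) / (a + 1)\<close> is the variance of the Beta law with parameters
  \<open>s\<close> and \<open>a - s\<close>.\<close>

lemma dirichlet_variance_linear_le:
  fixes c :: "nat \<Rightarrow> real"
  assumes n: "1 \<le> n" and \<alpha>: "\<And>i. i \<in> {1..n} \<Longrightarrow> 0 < \<alpha> i"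
    and c: "\<And>i. i \<in> {1..n} \<Longrightarrow> 0 \<le> c i \<and> c i \<le> 1"
  shows "(\<integral>x. (\<Sum>i=1..n. c i * x i)\<^sup>2 \<partial>dirichlet n \<alpha>) - (\<integral>x. (\<Sum>i=1..n. c i * x i) \<partial>dirichlet n \<alpha>)\<^sup>2
    \<le> 1 / (4 * (1 + (\<Sum>i=1..n. \<alpha> i)))"
proof -
  define a where "a = (\<Sum>i=1..n. \<alpha> i)"
  define s where "s = (\<Sum>i=1..n. c i * \<alpha> i)"
  define m where "m = s / a"
  have a: "0 < a" unfolding a_def by (rule sum_pos_atLeastAtMost[of n \<alpha>, OF n \<alpha>])
  \<comment> \<open>Here \<open>c j \<le> 1\<close> enters; for weights in {0, 1} this is an
    equality.\<close>
  have "(\<Sum>j=1..n. c j * \<alpha> j * (s + c j)) \<le> (\<Sum>j=1..n. c j * \<alpha> j * (s + 1))"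
    using \<alpha> c by (intro sum_mono mult_left_mono mult_nonneg_nonneg) (auto simp: less_imp_le)
  also have "\<dots> = s * (s + 1)" by (simp add: s_def sum_distrib_right)
  finally have "(\<Sum>j=1..n. c j * \<alpha> j * (s + c j)) / (a * (a + 1)) - (s / a)\<^sup>2
      \<le> s * (s + 1) / (a * (a + 1)) - (s / a)\<^sup>2"
    using a by (simp add: divide_right_mono)
  also have "\<dots> = m * (1 - m) / (a + 1)"
  proof -
    have "s = m * a" using a by (simp add: m_def)
    then have "s * (s + 1) / (a * (a + 1)) = m * (m * a + 1) / (a + 1)" using a by simp
    moreover have "(s / a)\<^sup>2 = m\<^sup>2 * (a + 1) / (a + 1)" using a by (simp add: m_def)
    ultimately show ?thesis
      by (simp add: diff_divide_distrib[symmetric] algebra_simps power2_eq_square)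
  qed
  also have "m * (1 - m) / (a + 1) \<le> (1 / 4) / (a + 1)"
  proof (rule divide_right_mono)
    show "m * (1 - m) \<le> 1 / 4"
      using zero_le_power2[of "m - 1 / 2"] by (simp add: power2_eq_square algebra_simps)
  qed (use a in simp)
  finally show ?thesis
    using dirichlet_second_moment_linear[of n \<alpha> c, OF n \<alpha> c] dirichlet_mean_linear[of n \<alpha> c, OF n \<alpha>]
    by (simp add: a_def[symmetric] s_def[symmetric] add.commute)
qed

section \<open>Deviation of two independent copies\<close>

text \<open>Independence makes the mixed moment equal to \<open>\<mu>\<^sup>2\<close>, so the second
  moment of \<open>X - Y\<close> is the sum of the two variances. Equal means make
  \<open>X - Y\<close> centred, so Chebyshev's inequality bounds the difference itself.\<close>

lemma (in prob_space) indep_deviation_le: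
  fixes X Y :: "'a \<Rightarrow> real"
  assumes ind: "indep_var borel X borel Y"
    and X2: "integrable M (\<lambda>\<omega>. (X \<omega>)\<^sup>2)" and Y2: "integrable M (\<lambda>\<omega>. (Y \<omega>)\<^sup>2)"
    and mean: "expectation X = \<mu>" "expectation Y = \<mu>"
    and var: "expectation (\<lambda>\<omega>. (X \<omega>)\<^sup>2) - \<mu>\<^sup>2 \<le> v" "expectation (\<lambda>\<omega>. (Y \<omega>)\<^sup>2) - \<mu>\<^sup>2 \<le> v"
    and \<eta>: "0 < \<eta>"
  shows "prob {\<omega> \<in> space M. \<bar>X \<omega> - Y \<omega>\<bar> \<ge> \<eta>} \<le> 2 * v / \<eta>\<^sup>2"
proof -
  have [measurable]: "random_variable borel X" "random_variable borel Y"
    using indep_var_rv1[OF ind] indep_var_rv2[OF ind] by auto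
  have X: "integrable M X" and Y: "integrable M Y"
    using X2 Y2 by (auto intro: square_integrable_imp_integrable)
  note XY = indep_var_integrable[OF ind X Y]
  have sq: "(X \<omega> - Y \<omega>)\<^sup>2 = (X \<omega>)\<^sup>2 + (Y \<omega>)\<^sup>2 - 2 * (X \<omega> * Y \<omega>)" for \<omega>
    by (simp add: power2_eq_square algebra_simps)
  have int: "integrable M (\<lambda>\<omega>. (X \<omega> - Y \<omega>)\<^sup>2)"
    unfolding sq using X2 Y2 XY by auto
  have mean0: "expectation (\<lambda>\<omega>. X \<omega> - Y \<omega>) = 0"
    using X Y mean by simp
  have "expectation (\<lambda>\<omega>. (X \<omega> - Y \<omega>)\<^sup>2)
      = expectation (\<lambda>\<omega>. (X \<omega>)\<^sup>2) + expectation (\<lambda>\<omega>. (Y \<omega>)\<^sup>2) - 2 * \<mu>\<^sup>2"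
    unfolding sq using X2 Y2 XY indep_var_lebesgue_integral[OF ind X Y] mean
    by (simp add: power2_eq_square)
  then have le: "expectation (\<lambda>\<omega>. (X \<omega> - Y \<omega>)\<^sup>2) \<le> 2 * v" using var by simp
  have "prob {\<omega> \<in> space M. \<bar>X \<omega> - Y \<omega>\<bar> \<ge> \<eta>} \<le> expectation (\<lambda>\<omega>. (X \<omega> - Y \<omega>)\<^sup>2) / \<eta>\<^sup>2"
    using Chebyshev_inequality[of "\<lambda>\<omega>. X \<omega> - Y \<omega>" \<eta>] int \<eta> mean0 by simp
  also have "\<dots> \<le> 2 * v / \<eta>\<^sup>2" using le by (intro divide_right_mono) auto
  finally show ?thesis .
qed

lemma dirichlet_average_deviation_le:
  fixes c :: "nat \<Rightarrow> real"
  assumes n: "1 \<le> n" and \<alpha>: "\<And>i. i \<in> {1..n} \<Longrightarrow> 0 < \<alpha> i"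
    and c: "\<And>i. i \<in> {1..n} \<Longrightarrow> 0 \<le> c i \<and> c i \<le> 1"
    and \<Omega>: "prob_space \<Omega>"
    and ind: "prob_space.indep_var \<Omega> (PiM {1..n} (\<lambda>_. borel)) p' (PiM {1..n} (\<lambda>_. borel)) p''"
    and p': "distr \<Omega> (PiM {1..n} (\<lambda>_. borel)) p' = dirichlet n \<alpha>"
    and p'': "distr \<Omega> (PiM {1..n} (\<lambda>_. borel)) p'' = dirichlet n \<alpha>"
    and \<eta>: "0 < \<eta>"
  shows "measure \<Omega> {\<omega> \<in> space \<Omega>. \<bar>(\<Sum>i=1..n. c i * p' \<omega> i) - (\<Sum>i=1..n. c i * p'' \<omega> i)\<bar> \<ge> \<eta>}
    \<le> 1 / (2 * \<eta>\<^sup>2 * (1 + (\<Sum>i=1..n. \<alpha> i)))"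
proof -
  interpret prob_space \<Omega> by (rule \<Omega>)
  let ?B = "PiM {1..n} (\<lambda>_. borel :: real measure)"
  define f where "f = (\<lambda>x::nat \<Rightarrow> real. \<Sum>i=1..n. c i * x i)"
  define v where "v = 1 / (4 * (1 + (\<Sum>i=1..n. \<alpha> i)))"
  have f [measurable]: "f \<in> borel_measurable ?B"
    unfolding f_def by (rule measurable_PiM_linear)
  have int2: "integrable (dirichlet n \<alpha>) (\<lambda>x. (f x)\<^sup>2)"
  proof (rule integrable_dirichlet_bounded[where B = 1, OF n \<alpha>])
    fix x :: "nat \<Rightarrow> real" assume "\<forall>i\<in>{1..n}. 0 \<le> x i" "(\<Sum>i=1..n. x i) = 1"
    then show "\<bar>(f x)\<^sup>2\<bar> \<le> 1"
      using simplex_average_le_1[of n x c] c by (simp add: f_def abs_square_le_1)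
  qed measurable
  \<comment> \<open>Moments and integrability depend only on the law of \<open>q\<close>, so one
    transfer from \<open>dirichlet n \<alpha>\<close> serves both \<open>p'\<close> and
    \<open>p''\<close>.\<close>
  have law: "expectation (\<lambda>\<omega>. f (q \<omega>)) = (\<integral>x. f x \<partial>dirichlet n \<alpha>)
      \<and> expectation (\<lambda>\<omega>. (f (q \<omega>))\<^sup>2) = (\<integral>x. (f x)\<^sup>2 \<partial>dirichlet n \<alpha>)
      \<and> integrable \<Omega> (\<lambda>\<omega>. (f (q \<omega>))\<^sup>2)"
    if q: "q \<in> measurable \<Omega> ?B" "distr \<Omega> ?B q = dirichlet n \<alpha>" for q
    using int2 unfolding q(2)[symmetric] using q(1)
    by (simp add: integral_distr integrable_distr_eq)
  have rv: "p' \<in> measurable \<Omega> ?B" "p'' \<in> measurable \<Omega> ?B"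
    using indep_var_rv1[OF ind] indep_var_rv2[OF ind] by auto
  have "prob {\<omega> \<in> space \<Omega>. \<bar>f (p' \<omega>) - f (p'' \<omega>)\<bar> \<ge> \<eta>} \<le> 2 * v / \<eta>\<^sup>2"
  proof (rule indep_deviation_le[where \<mu> = "\<integral>x. f x \<partial>dirichlet n \<alpha>"])
    show "indep_var borel (\<lambda>\<omega>. f (p' \<omega>)) borel (\<lambda>\<omega>. f (p'' \<omega>))"
      using indep_var_compose[OF ind f f] by (simp add: comp_def)
  qed (use law[OF rv(1) p'] law[OF rv(2) p''] \<eta> dirichlet_variance_linear_le[OF n \<alpha> c] in \<open>simp_all add: f_def v_def\<close>)
  also have "2 * v / \<eta>\<^sup>2 = 1 / (2 * \<eta>\<^sup>2 * (1 + (\<Sum>i=1..n. \<alpha> i)))"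
    by (simp add: v_def divide_simps)
  finally show ?thesis by (simp add: f_def)
qed

section \<open>The success probability as a linear average\<close>

lemma finite_joint_moves [simp]: "finite (joint_moves L N M)"
  by (simp add: joint_moves_def finite_PiE)

text \<open>These are the bounds on the weights \<open>c i\<close>: \<open>success\<close> is 0 or
  1, and a mass function gives a finite set total mass at most 1.\<close>

lemma success_average_bounds:
  "0 \<le> (\<Sum>X\<in>joint_moves L N M. success L M A X * pmf \<psi> X)"
  "(\<Sum>X\<in>joint_moves L N M. success L M A X * pmf \<psi> X) \<le> 1"
proof -
  show "0 \<le> (\<Sum>X\<in>joint_moves L N M. success L M A X * pmf \<psi> X)"
    by (intro sum_nonneg) (simp add: success_def)
  have "(\<Sum>X\<in>joint_moves L N M. success L M A X * pmf \<psi> X) \<le> (\<Sum>X\<in>joint_moves L N M. pmf \<psi> X)"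
    by (intro sum_mono) (simp add: success_def)
  also have "\<dots> = measure (measure_pmf \<psi>) (joint_moves L N M)"
    by (simp add: measure_measure_pmf_finite)
  also have "\<dots> \<le> 1" by simp
  finally show "(\<Sum>X\<in>joint_moves L N M. success L M A X * pmf \<psi> X) \<le> 1" .
qed

text \<open>Injectivity of \<open>P\<close> lets \<open>mass_of_vector\<close> return
  \<open>v i\<close> at \<open>P i\<close>. Reindexing the patterns by \<open>P\<close> then gives a
  linear function of \<open>v\<close>, the form the moment lemmas treat.\<close>

lemma success_prob_mass_of_vector:
  assumes P: "bij_betw P {1..n} (activation_patterns L N)"
  shows "success_prob L N M \<psi> (mass_of_vector n P v)
    = (\<Sum>i=1..n. (\<Sum>X\<in>joint_moves L N M. success L M (P i) X * pmf \<psi> X) * v i)"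
proof -
  have "mass_of_vector n P v (P i) = v i" if "i \<in> {1..n}" for i
    using that P by (simp add: mass_of_vector_def bij_betw_def the_inv_into_f_f)
  then show ?thesis
    unfolding success_prob_def sum.reindex_bij_betw[OF P, symmetric]
    by (intro sum.cong) (auto simp: mult.commute)
qed

theorem theorem3:
  fixes L N M K :: nat
    and P :: "nat \<Rightarrow> pattern"
    and \<alpha> :: "nat \<Rightarrow> real" and \<alpha>\<^sub>\<epsilon> \<eta> :: real
    and \<Omega> :: "'w measure" and p' p'' :: "'w \<Rightarrow> nat \<Rightarrow> real"
    and \<psi> :: "joint_move pmf" and \<xi>' \<xi>'' :: "'w \<Rightarrow> real"
  assumes "L \<ge> 1" and "N \<ge> 1" and "M \<ge> 1" and "M \<ge> L" and "K = L * N"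
    and "bij_betw P {1..2 ^ K} (activation_patterns L N)"
    and "\<And>i. i \<in> {1..2 ^ K} \<Longrightarrow> \<alpha> i > 0"
    and "\<alpha>\<^sub>\<epsilon> = Min (\<alpha> ` {1..2 ^ K})"
    and "prob_space \<Omega>"
    and "p' \<in> measurable \<Omega> (PiM {1..2 ^ K} (\<lambda>_. borel))"
    and "p'' \<in> measurable \<Omega> (PiM {1..2 ^ K} (\<lambda>_. borel))"
    and "prob_space.indep_var \<Omega> (PiM {1..2 ^ K} (\<lambda>_. borel)) p' (PiM {1..2 ^ K} (\<lambda>_. borel)) p''"
    and "distr \<Omega> (PiM {1..2 ^ K} (\<lambda>_. borel)) p' = dirichlet (2 ^ K) \<alpha>"
    and "distr \<Omega> (PiM {1..2 ^ K} (\<lambda>_. borel)) p'' = dirichlet (2 ^ K) \<alpha>"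
    and "joint_strategy L N M \<psi>" and "deterministic \<psi>"
    and "\<xi>' = (\<lambda>\<omega>. success_prob L N M \<psi> (mass_of_vector (2 ^ K) P (p' \<omega>)))"
    and "\<xi>'' = (\<lambda>\<omega>. success_prob L N M \<psi> (mass_of_vector (2 ^ K) P (p'' \<omega>)))"
    and "0 < \<eta>" and "\<eta> \<le> 1"
  shows "measure \<Omega> {\<omega> \<in> space \<Omega>. \<bar>\<xi>' \<omega> - \<xi>'' \<omega>\<bar> \<ge> \<eta>}
    \<le> 1 / (2 * \<eta>\<^sup>2 * (1 + \<alpha>\<^sub>\<epsilon> * 2 ^ K))"
proof -
  let ?n = "2 ^ K :: nat"
  let ?c = "\<lambda>i. \<Sum>X\<in>joint_moves L N M. success L M (P i) X * pmf \<psi> X"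
  have n: "1 \<le> ?n" by simp
  \<comment> \<open>The minimum is compared termwise with the \<open>2 ^ K\<close>
    parameters.\<close>
  have "\<alpha>\<^sub>\<epsilon> * 2 ^ K = (\<Sum>i=1..?n. \<alpha>\<^sub>\<epsilon>)" by simp
  also have "\<dots> \<le> (\<Sum>i=1..?n. \<alpha> i)"
    unfolding assms(8) by (intro sum_mono Min_le) auto
  finally have min_le: "\<alpha>\<^sub>\<epsilon> * 2 ^ K \<le> (\<Sum>i=1..?n. \<alpha> i)" .
  \<comment> \<open>The minimum is attained, hence positive. This keeps the smaller denominator
    positive when the reciprocals are compared at the end.\<close>
  have "\<alpha>\<^sub>\<epsilon> \<in> \<alpha> ` {1..?n}"
    unfolding assms(8) using n by (intro Min_in) auto
  then have "0 < \<alpha>\<^sub>\<epsilon>" using assms(7) by blast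
  have "measure \<Omega> {\<omega> \<in> space \<Omega>. \<bar>\<xi>' \<omega> - \<xi>'' \<omega>\<bar> \<ge> \<eta>}
      \<le> 1 / (2 * \<eta>\<^sup>2 * (1 + (\<Sum>i=1..?n. \<alpha> i)))"
    unfolding assms(17,18) success_prob_mass_of_vector[OF assms(6)]
    using success_average_bounds
    by (intro dirichlet_average_deviation_le[OF n assms(7) _ assms(9,12,13,14,19)]) auto
  also have "\<dots> \<le> 1 / (2 * \<eta>\<^sup>2 * (1 + \<alpha>\<^sub>\<epsilon> * 2 ^ K))"
  proof -
    have "0 < 1 + \<alpha>\<^sub>\<epsilon> * 2 ^ K"
      using \<open>0 < \<alpha>\<^sub>\<epsilon>\<close> by (simp add: add_pos_nonneg)
    then show ?thesis
      using min_le assms(19) by (intro divide_left_mono mult_left_mono mult_pos_pos) auto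
  qed
  finally show ?thesis .
qed

end
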